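(* Let $f=\sum_{j=1}^mf_j$ on $\mathbf{R}^N$, where each $f_j$ is convex and differentiable and depends only on the blocks $x^{(i)}$ with $i\in C_j\subseteq[n]$, $\omega_j=|C_j|$, and suppose there are constants $L_{ji}\ge0$, with $L_{ji}=0$ for $i\notin C_j$, such that $$\|\nabla_if_j(x+U_it)-\nabla_if_j(x)\|_{(i)}^*\le L_{ji}\|t\|_{(i)}\qquad\text{for all }i,j,\ x\in\mathbf{R}^N,\ t\in\mathbf{R}^{N_i}.$$ Let $v_i=\sum_{j=1}^m\omega_jL_{ji}$ and assume $v_i>0$ for all $i\in[n]$. Let $\psi(x)=\sum_{i=1}^n\psi_i(x^{(i)})$ with each $\psi_i:\mathbf{R}^{N_i}\to\mathbf{R}\cup\{+\infty\}$ convex, $F=f+\psi$, $x_0\in\operatorname{dom}\psi$, and let $x_*$ be a minimizer of $F$ over $\mathbf{R}^N$. Run the (deterministic) APPROX algorithm in which all blocks are updated in each iteration ($\tau=n$), as described in the context, with these $v_i$. Then for all $k\ge1$, $$F(x_k)-F(x_* )\le\frac{2\bar\omega\bar L}{(k+1)^2}\|x_0-x_*\|_w^2,$$ where $$\bar\omega=\sum_{j}\omega_j\frac{\sum_{i}L_{ji}}{\sum_{k,i}L_{ki}},\qquad\bar L=\frac{\sum_{j,i}L_{ji}}{n},\qquad w_i=\frac{n}{\sum_{j,l}\omega_jL_{jl}}\sum_j\omega_jL_{ji}.$$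
   Context: Blocks: $N=N_1+\dots+N_n$, $[n]=\{1,\dots,n\}$; the $N\times N$ identity matrix is split into column submatrices $U=[U_1,\dots,U_n]$ with $U_i\in\mathbf{R}^{N\times N_i}$. For $x\in\mathbf{R}^N$, $x^{(i)}=U_i^Tx\in\mathbf{R}^{N_i}$. For differentiable $g$, $\nabla_ig(x)=U_i^T\nabla g(x)$. Norms: for each $i$ a symmetric positive definite matrix $B_i\in\mathbf{R}^{N_i\times N_i}$ is fixed; $\|t\|_{(i)}=\langle B_it,t\rangle^{1/2}$ and $\|t\|_{(i)}^*=\langle B_i^{-1}t,t\rangle^{1/2}$ for $t\in\mathbf{R}^{N_i}$. For positive weights $w=(w_1,\dots,w_n)$, $\|x\|_w^2=\sum_{i=1}^nw_i\|x^{(i)}\|_{(i)}^2$. APPROX algorithm with $\tau=n$: set $z_0=x_0$, $\theta_0=1$. For $k=0,1,2,\dots$: 1. $y_k=(1-\theta_k)x_k+\theta_kz_k$. 2. For every $i\in[n]$, $$z_{k+1}^{(i)}=\arg\min_{z\in\mathbf{R}^{N_i}}\left\{\langle\nabla_if(y_k),z-y_k^{(i)}\rangle+\frac{\theta_kv_i}{2}\|z-z_k^{(i)}\|_{(i)}^2+\psi_i(z)\right\}.$$ 3. $x_{k+1}=y_k+\theta_k(z_{k+1}-z_k)$. 4. $\theta_{k+1}=\frac{\sqrt{\theta_k^4+4\theta_k^2}-\theta_k^2}{2}$. The minimizers in step 2 are assumed to exist, so that the algorithm is well defined. *)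

theory Defs
  imports "HOL-Analysis.Analysis"
begin

text \<open>
  The block structure of \<open>\<real>\<^sup>N\<close> is a map \<open>b\<close> sending each coordinate to the block containing it.
  As the sizes \<open>N\<^sub>i\<close> depend on \<open>i\<close>, the block space of dimension \<open>N\<^sub>i\<close> is encoded by zero-padding: it is
  the coordinate subspace of vectors vanishing off block \<open>i\<close>. Accordingly \<open>U\<^sub>i\<close> (here \<open>block_U\<close>) is the submatrix
  of the identity consisting of the columns of block \<open>i\<close>, the other columns being zero, and
  square matrices on block \<open>i\<close> are those vanishing off block \<open>i\<close>; \<open>U\<^sub>i\<close> is also the padded form of
  the identity matrix of block \<open>i\<close>.
\<close>

definition block_space :: "('N::finite \<Rightarrow> 'n) \<Rightarrow> 'n \<Rightarrow> (real^'N) set" where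
  "block_space b i = {t. \<forall>l. b l \<noteq> i \<longrightarrow> t $ l = 0}"

definition block_mats :: "('N::finite \<Rightarrow> 'n) \<Rightarrow> 'n \<Rightarrow> (real^'N^'N) set" where
  "block_mats b i = {A. \<forall>r c. b r \<noteq> i \<or> b c \<noteq> i \<longrightarrow> A $ r $ c = 0}"

definition block_U :: "('N::finite \<Rightarrow> 'n) \<Rightarrow> 'n \<Rightarrow> real^'N^'N" where
  "block_U b i = (\<chi> r c. if b c = i then mat 1 $ r $ c else 0)"

definition blk :: "('N::finite \<Rightarrow> 'n) \<Rightarrow> 'n \<Rightarrow> real^'N \<Rightarrow> real^'N" where
  "blk b i x = transpose (block_U b i) *v x"

definition block_inv :: "('N::finite \<Rightarrow> 'n) \<Rightarrow> 'n \<Rightarrow> real^'N^'N \<Rightarrow> real^'N^'N" where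
  "block_inv b i A = (THE C. C \<in> block_mats b i \<and> A ** C = block_U b i \<and> C ** A = block_U b i)"

definition spd_block :: "('N::finite \<Rightarrow> 'n) \<Rightarrow> 'n \<Rightarrow> real^'N^'N \<Rightarrow> bool" where
  "spd_block b i A \<longleftrightarrow> A \<in> block_mats b i \<and> transpose A = A \<and>
     (\<forall>t\<in>block_space b i. t \<noteq> 0 \<longrightarrow> (A *v t) \<bullet> t > 0)"

definition block_norm :: "('n \<Rightarrow> real^'N^'N) \<Rightarrow> 'n \<Rightarrow> real^'N \<Rightarrow> real" where
  "block_norm B i t = sqrt ((B i *v t) \<bullet> t)"

definition dual_block_norm ::
  "('N::finite \<Rightarrow> 'n) \<Rightarrow> ('n \<Rightarrow> real^'N^'N) \<Rightarrow> 'n \<Rightarrow> real^'N \<Rightarrow> real" where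
  "dual_block_norm b B i t = sqrt ((block_inv b i (B i) *v t) \<bullet> t)"

definition weighted_norm ::
  "('N::finite \<Rightarrow> 'n::finite) \<Rightarrow> ('n \<Rightarrow> real^'N^'N) \<Rightarrow> ('n \<Rightarrow> real) \<Rightarrow> real^'N \<Rightarrow> real" where
  "weighted_norm b B w x = sqrt (\<Sum>i\<in>UNIV. w i * (block_norm B i (blk b i x))\<^sup>2)"

definition grad :: "('a::real_inner \<Rightarrow> real) \<Rightarrow> 'a \<Rightarrow> 'a" where
  "grad g x = (THE D. GDERIV g x :> D)"

definition block_grad :: "('N::finite \<Rightarrow> 'n) \<Rightarrow> 'n \<Rightarrow> (real^'N \<Rightarrow> real) \<Rightarrow> real^'N \<Rightarrow> real^'N" where
  "block_grad b i g x = transpose (block_U b i) *v grad g x"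

definition depends_only_on_blocks ::
  "('N::finite \<Rightarrow> 'n) \<Rightarrow> 'n set \<Rightarrow> (real^'N \<Rightarrow> real) \<Rightarrow> bool" where
  "depends_only_on_blocks b C g \<longleftrightarrow>
     (\<forall>x y. (\<forall>i\<in>C. blk b i x = blk b i y) \<longrightarrow> g x = g y)"

text \<open>Convexity with values in \<open>\<real> \<union> {+\<infinity>}\<close>. In \<^typ>\<open>ereal\<close> we have \<open>0 * \<infinity> = 0\<close>, so
  the endpoints \<open>u = 0, 1\<close> impose nothing.\<close>

definition ereal_convex_on :: "'a::real_vector set \<Rightarrow> ('a \<Rightarrow> ereal) \<Rightarrow> bool" where
  "ereal_convex_on S g \<longleftrightarrow> convex S \<and> (\<forall>s\<in>S. g s \<noteq> - \<infinity>) \<and>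
     (\<forall>s\<in>S. \<forall>t\<in>S. \<forall>u\<in>{0..1::real}.
        g ((1 - u) *\<^sub>R s + u *\<^sub>R t) \<le> ereal (1 - u) * g s + ereal u * g t)"

definition separable ::
  "('N::finite \<Rightarrow> 'n::finite) \<Rightarrow> ('n \<Rightarrow> real^'N \<Rightarrow> ereal) \<Rightarrow> real^'N \<Rightarrow> ereal" where
  "separable b \<psi> x = (\<Sum>i\<in>UNIV. \<psi> i (blk b i x))"

definition approx_run ::
  "('N::finite \<Rightarrow> 'n) \<Rightarrow> ('n \<Rightarrow> real^'N^'N) \<Rightarrow> (real^'N \<Rightarrow> real) \<Rightarrow>
   ('n \<Rightarrow> real^'N \<Rightarrow> ereal) \<Rightarrow> ('n \<Rightarrow> real) \<Rightarrow>
   (nat \<Rightarrow> real^'N) \<Rightarrow> (nat \<Rightarrow> real^'N) \<Rightarrow> (nat \<Rightarrow> real^'N) \<Rightarrow> (nat \<Rightarrow> real) \<Rightarrow> bool" where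
  "approx_run b B f \<psi> v x y z \<theta> \<longleftrightarrow>
     z 0 = x 0 \<and> \<theta> 0 = 1 \<and>
     (\<forall>k.
        y k = (1 - \<theta> k) *\<^sub>R x k + \<theta> k *\<^sub>R z k \<and>
        (\<forall>i. is_arg_min
               (\<lambda>t. ereal (block_grad b i f (y k) \<bullet> (t - blk b i (y k))
                            + \<theta> k * v i / 2 * (block_norm B i (t - blk b i (z k)))\<^sup>2)
                     + \<psi> i t)
               (\<lambda>t. t \<in> block_space b i)
               (blk b i (z (Suc k)))) \<and>
        x (Suc k) = y k + \<theta> k *\<^sub>R (z (Suc k) - z k) \<and>
        \<theta> (Suc k) = (sqrt (\<theta> k ^ 4 + 4 * (\<theta> k)\<^sup>2) - (\<theta> k)\<^sup>2) / 2)"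

definition omega_bar :: "('m::finite \<Rightarrow> 'n::finite set) \<Rightarrow> ('m \<Rightarrow> 'n \<Rightarrow> real) \<Rightarrow> real" where
  "omega_bar C L =
     (\<Sum>j\<in>UNIV. real (card (C j)) * ((\<Sum>i\<in>UNIV. L j i) / (\<Sum>k\<in>UNIV. \<Sum>i\<in>UNIV. L k i)))"

definition L_bar :: "('m::finite \<Rightarrow> 'n::finite \<Rightarrow> real) \<Rightarrow> real" where
  "L_bar L = (\<Sum>j\<in>UNIV. \<Sum>i\<in>UNIV. L j i) / real CARD('n)"

definition norm_weight :: "('m::finite \<Rightarrow> 'n::finite set) \<Rightarrow> ('m \<Rightarrow> 'n \<Rightarrow> real) \<Rightarrow> 'n \<Rightarrow> real" where
  "norm_weight C L i =
     real CARD('n) / (\<Sum>j\<in>UNIV. \<Sum>l\<in>UNIV. real (card (C j)) * L j l)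
       * (\<Sum>j\<in>UNIV. real (card (C j)) * L j i)"

end

(* The overapproximation f(q + h) <= f(q) + <grad f(q), h> + 1/2 sum_i v_i |h_i|^2 turns each
   iteration into an accelerated proximal gradient step (Tseng) for the norm with weights v: for
   a_k = F(x_k) - F(xstar) and D_k = sum_i v_i |xstar_i - z_{k,i}|^2 one gets
   a_{k+1} <= (1 - theta_k) a_k + theta_k^2 / 2 (D_k - D_{k+1}).  Dividing by theta_k^2, this telescopes
   to a_{k+1} <= theta_k^2 / 2 D_0, and theta_k <= 2 / (k + 2).  Finally the product of omega_bar,
   L_bar and the squared w-norm is exactly the squared v-norm. *)

theory Submission
  imports Defs
begin

section \<open>Blocks and block norms\<close>

text \<open>Two curvatures have to match. Since x_{k+1} - y_k = theta_k (z_{k+1} - z_k), the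
  quadratic term of the overapproximation carries theta_k^2; the subproblems have weight theta_k
  v_i, and their inequality enters multiplied by theta_k. Hence the terms in z_{k+1} - z_k cancel
  exactly and only D_k - D_{k+1} survives. The factor omega_j in v_i is the price of moving all
  blocks of f_j at once. As theta_0 = 1, the initial gap a_0 drops out, which is why the bound
  involves D_0 alone. An obstacle is that psi_i may be infinite: the argument first shows that the
  blocks of xstar and of all x_k and z_{k+1} lie in the effective domains, and only there passes to
  real values.\<close>

lemma blk_nth: "blk b i x $ l = (if b l = i then x $ l else 0)"
proof -
  have "blk b i x $ l = (\<Sum>r\<in>UNIV. (if b l = i then mat 1 $ r $ l else 0) * x $ r)"
    by (simp add: blk_def block_U_def transpose_def matrix_vector_mult_def del: transpose_matrix_vector)
  also have "\<dots> = (\<Sum>r\<in>UNIV. if r = l then (if b l = i then x $ r else 0) else 0)"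
    by (rule sum.cong) (auto simp: mat_def)
  finally show ?thesis by simp
qed

lemma block_U_mult: "block_U b i *v x = blk b i x"
proof -
  have "(block_U b i *v x) $ l = (\<Sum>c\<in>UNIV. if c = l then (if b l = i then x $ c else 0) else 0)" for l
    unfolding block_U_def matrix_vector_mult_def vec_lambda_beta by (rule sum.cong) (auto simp: mat_def)
  then show ?thesis by (simp add: vec_eq_iff blk_nth)
qed

lemma block_grad_eq: "block_grad b i g x = blk b i (grad g x)"
  by (simp add: block_grad_def blk_def)

lemma linear_blk: "linear (blk b i)"
  by (rule linearI) (auto simp: vec_eq_iff blk_nth)

lemmas blk_add = linear_add[OF linear_blk]
  and blk_diff = linear_diff[OF linear_blk]
  and blk_scaleR = linear_cmul[OF linear_blk]

lemma blk_in_block_space: "blk b i x \<in> block_space b i"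
  by (simp add: block_space_def blk_nth)

lemma blk_ident: "t \<in> block_space b i \<Longrightarrow> blk b i t = t"
  by (auto simp: block_space_def blk_nth vec_eq_iff)

lemma sum_blk: "(\<Sum>i\<in>UNIV. blk b i x) = (x :: real^'N)" for b :: "'N::finite \<Rightarrow> 'n::finite"
  by (simp add: vec_eq_iff blk_nth)

lemma inner_blk: "x \<bullet> blk b i y = blk b i x \<bullet> blk b i y"
  unfolding inner_vec_def by (rule sum.cong) (auto simp: blk_nth)

lemma inner_sum_blk: "x \<bullet> y = (\<Sum>i\<in>UNIV. blk b i x \<bullet> blk b i y)"
  for b :: "'N::finite \<Rightarrow> 'n::finite"
proof -
  have "x \<bullet> y = x \<bullet> (\<Sum>i\<in>UNIV. blk b i y)" by (simp add: sum_blk)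
  also have "\<dots> = (\<Sum>i\<in>UNIV. x \<bullet> blk b i y)" by (simp add: inner_sum_right)
  also have "\<dots> = (\<Sum>i\<in>UNIV. blk b i x \<bullet> blk b i y)" by (rule sum.cong[OF refl]) (rule inner_blk)
  finally show ?thesis .
qed

lemma block_mats_mult_U:
  assumes "A \<in> block_mats b i"
  shows "A ** block_U b i = A" "block_U b i ** A = A"
proof -
  have *: "(A *v blk b i x) $ r = (A *v x) $ r" "blk b i (A *v x) $ r = (A *v x) $ r" for x r
    using assms unfolding block_mats_def matrix_vector_mult_def
    by (auto simp: blk_nth intro!: sum.cong)
  show "A ** block_U b i = A" "block_U b i ** A = A"
    by (auto simp: matrix_eq matrix_vector_mul_assoc[symmetric] block_U_mult vec_eq_iff *)
qed

lemma block_mats_mult_blk: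
  assumes "A \<in> block_mats b i"
  shows "A *v blk b i x = A *v x" "blk b i (A *v x) = A *v x"
  using block_mats_mult_U[OF assms]
  by (metis block_U_mult matrix_vector_mul_assoc)+

text \<open>A padded matrix sees only the block component of its argument, so outside the block
  space the form can vanish but not become negative.\<close>

lemma spd_block_nonneg:
  assumes "spd_block b i A"
  shows "(A *v t) \<bullet> t \<ge> 0"
proof -
  have A: "A \<in> block_mats b i" and pos: "\<And>t. t \<in> block_space b i \<Longrightarrow> t \<noteq> 0 \<Longrightarrow> (A *v t) \<bullet> t > 0"
    using assms by (auto simp: spd_block_def)
  have "(A *v t) \<bullet> t = (A *v blk b i t) \<bullet> blk b i t"
    using inner_blk[of t b i "A *v t"] by (simp add: block_mats_mult_blk[OF A] inner_commute)
  also have "\<dots> \<ge> 0"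
    using pos[OF blk_in_block_space, of t] by (cases "blk b i t = 0") auto
  finally show ?thesis .
qed

lemma symmetric_matrix_inner:
  assumes "transpose A = (A :: real^'N^'N)"
  shows "(A *v s) \<bullet> t = (A *v t) \<bullet> s"
  by (metis assms dot_lmul_matrix inner_commute transpose_matrix_vector)

text \<open>Semidefinite forms are the right generality because a padded block matrix annihilates
  everything off its block. The inequality is the discriminant bound for a quadratic in
  \<open>r\<close> that is nonnegative everywhere.\<close>

lemma psd_Cauchy_Schwarz:
  assumes sym: "transpose A = (A :: real^'N^'N)" and psd: "\<And>t. (A *v t) \<bullet> t \<ge> 0"
  shows "(A *v s) \<bullet> t \<le> sqrt ((A *v s) \<bullet> s) * sqrt ((A *v t) \<bullet> t)"
proof -
  define q c where "q = (\<lambda>t. (A *v t) \<bullet> t)" and "c = (A *v s) \<bullet> t"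
  have quad: "0 \<le> q s - 2 * r * c + r\<^sup>2 * q t" for r
  proof -
    have "q (s - r *\<^sub>R t) = q s - 2 * r * c + r\<^sup>2 * q t"
      unfolding q_def c_def using symmetric_matrix_inner[OF sym, of t s]
      by (simp add: algebra_simps inner_diff_left inner_diff_right power2_eq_square)
    then show ?thesis using psd[of "s - r *\<^sub>R t"] by (simp add: q_def)
  qed
  have "c\<^sup>2 \<le> q s * q t"
  proof (cases "q t = 0")
    case True
    have "c = 0"
    proof (rule ccontr)
      assume "c \<noteq> 0"
      \<comment> \<open>With \<open>q t = 0\<close> the quadratic is affine in \<open>r\<close>, and
        this \<open>r\<close> gives it the value -1.\<close>
      then show False using quad[of "(q s + 1) / (2 * c)"] psd[of s] True by (simp add: q_def)
    qed
    then show ?thesis using True by simp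
  next
    case False
    then have "q t > 0" using psd[of t] by (simp add: q_def)
    then show ?thesis using quad[of "c / q t"] by (simp add: field_simps power2_eq_square)
  qed
  then have "c \<le> sqrt (q s * q t)" by (rule real_le_rsqrt)
  then show ?thesis by (simp add: q_def c_def real_sqrt_mult)
qed

text \<open>Adding the identity off block \<open>i\<close> makes \<open>A\<close> invertible on the whole space.\<close>

lemma block_inv_props:
  assumes "spd_block b i A"
  shows "block_inv b i A \<in> block_mats b i" "A ** block_inv b i A = block_U b i"
    "block_inv b i A ** A = block_U b i"
proof -
  let ?U = "block_U b i"
  have A: "A \<in> block_mats b i" and pos: "\<And>t. t \<in> block_space b i \<Longrightarrow> t \<noteq> 0 \<Longrightarrow> (A *v t) \<bullet> t > 0"
    using assms by (auto simp: spd_block_def)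
  note AU = block_mats_mult_U[OF A]
  have UU: "?U ** ?U = ?U"
    by (rule block_mats_mult_U) (auto simp: block_mats_def block_U_def mat_def)
  define M where "M = A + (mat 1 - ?U)"
  have "\<forall>x. M *v x = 0 \<longrightarrow> x = 0"
  proof safe
    fix x assume "M *v x = 0"
    then have 0: "A *v x + (x - blk b i x) = 0"
      by (simp add: M_def matrix_vector_mult_add_rdistrib matrix_vector_mult_diff_rdistrib block_U_mult)
    then have "blk b i (A *v x + (x - blk b i x)) = 0" by (simp add: linear_0[OF linear_blk])
    then have "A *v x = 0"
      using blk_ident[OF blk_in_block_space, of b i x]
      by (simp add: blk_add blk_diff block_mats_mult_blk[OF A])
    then have "A *v blk b i x = 0" by (simp add: block_mats_mult_blk[OF A])
    then have "blk b i x = 0" using pos[OF blk_in_block_space, of x] by force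
    with 0 \<open>A *v x = 0\<close> show "x = 0" by simp
  qed
  then obtain M' where M': "M' ** M = mat 1" using matrix_left_invertible_ker by blast
  then have M'': "M ** M' = mat 1" by (simp add: matrix_left_right_inverse)
  have UM: "?U ** M = A" "M ** ?U = A"
    by (simp_all add: matrix_eq M_def block_U_mult block_mats_mult_blk[OF A] blk_add blk_diff
        blk_ident[OF blk_in_block_space] matrix_vector_mult_add_rdistrib
        matrix_vector_mult_diff_rdistrib flip: matrix_vector_mul_assoc)
  \<comment> \<open>By \<open>UM\<close>, multiplying \<open>M\<close> by \<open>?U\<close> on
    either side gives \<open>A\<close>; compressing the inverse of \<open>M\<close> to the block
    therefore inverts \<open>A\<close> there.\<close>
  define C where "C = ?U ** M' ** ?U"
  have C_mult: "C *v x \<in> block_space b i" "C *v blk b i x = C *v x" for x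
    using UU by (auto simp: C_def matrix_vector_mul_assoc[symmetric] block_U_mult blk_in_block_space
        blk_ident)
  have C: "C \<in> block_mats b i"
  proof -
    have "C $ r $ c = 0" if "b r \<noteq> i \<or> b c \<noteq> i" for r c
    proof -
      have "C $ r $ c = (C *v axis c 1) $ r"
        by (simp add: matrix_vector_mul_component inner_axis)
      moreover have "blk b i (axis c 1) = 0" if "b c \<noteq> i"
        using that by (auto simp: vec_eq_iff blk_nth axis_def)
      ultimately show ?thesis
        using that C_mult[of "axis c 1"]
        by (cases "b r = i") (auto simp: block_space_def)
    qed
    then show ?thesis by (auto simp: block_mats_def)
  qed
  have AC: "A ** C = ?U"
  proof -
    have "A ** C = (A ** ?U) ** M' ** ?U" by (simp add: C_def matrix_mul_assoc)
    also have "\<dots> = ?U ** (M ** M') ** ?U" by (simp add: AU matrix_mul_assoc UM)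
    finally show ?thesis by (simp add: M'' UU)
  qed
  have CA: "C ** A = ?U"
  proof -
    have "C ** A = ?U ** M' ** A" by (simp add: C_def AU flip: matrix_mul_assoc)
    also have "\<dots> = ?U ** (M' ** M) ** ?U" by (simp add: UM(2)[symmetric] matrix_mul_assoc)
    finally show ?thesis by (simp add: M' UU)
  qed
  \<comment> \<open>\<open>block_inv\<close> is a definite description, so uniqueness of the inverse
    within the block is required as well.\<close>
  have "\<exists>!C. C \<in> block_mats b i \<and> A ** C = ?U \<and> C ** A = ?U"
  proof (rule ex1I[of _ C])
    fix D assume D: "D \<in> block_mats b i \<and> A ** D = ?U \<and> D ** A = ?U"
    then have "D = D ** (A ** C)" by (simp add: AC block_mats_mult_U)
    also have "\<dots> = ?U ** C" using D by (simp add: matrix_mul_assoc)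
    finally show "D = C" by (simp add: block_mats_mult_U[OF C])
  qed (use C AC CA in auto)
  from theI'[OF this]
  show "block_inv b i A \<in> block_mats b i" "A ** block_inv b i A = block_U b i"
    "block_inv b i A ** A = block_U b i"
    unfolding block_inv_def by auto
qed

lemma block_norm_nonneg: "spd_block b i (B i) \<Longrightarrow> block_norm B i t \<ge> 0"
  using spd_block_nonneg by (auto simp: block_norm_def)

lemma block_norm_squared: "spd_block b i (B i) \<Longrightarrow> (block_norm B i t)\<^sup>2 = (B i *v t) \<bullet> t"
  using spd_block_nonneg by (auto simp: block_norm_def)

lemma block_norm_scaleR: "block_norm B i (c *\<^sub>R t) = \<bar>c\<bar> * block_norm B i t"
  by (simp add: block_norm_def matrix_vector_mult_scaleR real_sqrt_mult
      mult.assoc[symmetric] flip: power2_eq_square)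

text \<open>This is Cauchy-Schwarz for the form \<open>B i\<close> at the preimage \<open>s\<close>
  of \<open>a\<close>: since \<open>B i *v s = a\<close>, the block norm of \<open>s\<close> is the
  dual norm of \<open>a\<close>.\<close>

lemma dual_block_norm_inner_le:
  assumes "spd_block b i (B i)" and a: "a \<in> block_space b i"
  shows "a \<bullet> t \<le> dual_block_norm b B i a * block_norm B i t"
proof -
  define s where "s = block_inv b i (B i) *v a"
  have "B i *v s = a"
    using block_inv_props(2)[OF assms(1)] blk_ident[OF a]
    by (simp add: s_def matrix_vector_mul_assoc block_U_mult)
  moreover have "(B i *v s) \<bullet> t \<le> sqrt ((B i *v s) \<bullet> s) * sqrt ((B i *v t) \<bullet> t)"
    using assms(1) spd_block_nonneg[OF assms(1)] by (intro psd_Cauchy_Schwarz) (auto simp: spd_block_def)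
  ultimately show ?thesis
    by (simp add: dual_block_norm_def block_norm_def s_def[symmetric] inner_commute)
qed

section \<open>Separable overapproximation\<close>

text \<open>\<open>grad\<close> is a definite description. The Riesz vector of the derivative, built
  from its values on \<open>Basis\<close>, gives existence; testing two candidates against their
  difference gives uniqueness.\<close>

lemma has_derivative_grad:
  fixes g :: "'a::euclidean_space \<Rightarrow> real"
  assumes "g differentiable (at x)"
  shows "(g has_derivative (\<lambda>h. grad g x \<bullet> h)) (at x)"
proof -
  obtain g' where g': "(g has_derivative g') (at x)" using assms by (auto simp: differentiable_def)
  then have lin: "linear g'" by (rule has_derivative_linear)
  define D where "D = (\<Sum>e\<in>Basis. g' e *\<^sub>R e)"
  have "g' h = h \<bullet> D" for h
  proof -
    have "g' h = g' (\<Sum>e\<in>Basis. (h \<bullet> e) *\<^sub>R e)" by (simp add: euclidean_representation)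
    also have "\<dots> = (\<Sum>e\<in>Basis. (h \<bullet> e) * g' e)"
      by (simp add: linear_sum[OF lin] linear_cmul[OF lin])
    finally show ?thesis by (simp add: D_def inner_sum_right mult.commute)
  qed
  then have "g' = (\<lambda>h. h \<bullet> D)" by (rule ext)
  then have "GDERIV g x :> D" using g' by (simp add: gderiv_def)
  moreover have "D' = D" if "GDERIV g x :> D'" for D'
  proof -
    have "(\<lambda>h. h \<bullet> D') = (\<lambda>h. h \<bullet> D)"
      using that \<open>GDERIV g x :> D\<close> unfolding gderiv_def by (rule has_derivative_unique)
    then have "(D' - D) \<bullet> D' = (D' - D) \<bullet> D" by metis
    then have "(D' - D) \<bullet> (D' - D) = 0" by (simp add: inner_diff_right)
    then show ?thesis by simp
  qed
  ultimately have "GDERIV g x :> grad g x" unfolding grad_def by (rule theI)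
  then show ?thesis by (simp add: gderiv_def inner_commute)
qed

lemma has_real_derivative_along_line:
  fixes g :: "'a::euclidean_space \<Rightarrow> real"
  assumes "g differentiable (at (p + s *\<^sub>R t))"
  shows "((\<lambda>s. g (p + s *\<^sub>R t)) has_real_derivative (grad g (p + s *\<^sub>R t) \<bullet> t)) (at s)"
proof -
  have "((\<lambda>s. p + s *\<^sub>R t) has_derivative (\<lambda>h. h *\<^sub>R t)) (at s)"
    by (auto intro!: derivative_eq_intros)
  from has_derivative_compose[OF this has_derivative_grad[OF assms]]
  show ?thesis by (simp add: has_field_derivative_def mult.commute mult_commute_abs)
qed

lemma convex_above_tangent:
  fixes g :: "'a::euclidean_space \<Rightarrow> real"
  assumes cvx: "convex_on UNIV g" and "g differentiable (at p)"
  shows "g p + grad g p \<bullet> h \<le> g (p + h)"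
proof -
  have "convex_on UNIV (\<lambda>s. g (p + s *\<^sub>R h))"
  proof (rule convex_onI)
    fix u s t :: real assume u: "0 < u" "u < 1"
    have "p + ((1 - u) *\<^sub>R s + u *\<^sub>R t) *\<^sub>R h = (1 - u) *\<^sub>R (p + s *\<^sub>R h) + u *\<^sub>R (p + t *\<^sub>R h)"
      by (simp add: algebra_simps)
    then show "g (p + ((1 - u) *\<^sub>R s + u *\<^sub>R t) *\<^sub>R h) \<le> (1 - u) * g (p + s *\<^sub>R h) + u * g (p + t *\<^sub>R h)"
      using convex_onD[OF cvx, of u] u by simp
  qed simp
  then have "g (p + 1 *\<^sub>R h) - g (p + 0 *\<^sub>R h) \<ge> (grad g p \<bullet> h) * (1 - 0)"
    using has_real_derivative_along_line[of g p 0 h] assms(2)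
    by (intro convex_on_imp_above_tangent[where A=UNIV]) auto
  then show ?thesis by simp
qed

text \<open>This is the descent lemma for a step inside one block. Instead of integrating the
  gradient along the segment, it shows that the function minus its claimed bound is
  nonincreasing.\<close>

lemma block_descent:
  assumes spd: "spd_block b i (B i)"
    and diff: "\<And>p. g differentiable (at p)"
    and lip: "\<And>p t. t \<in> block_space b i \<Longrightarrow>
           dual_block_norm b B i (block_grad b i g (p + block_U b i *v t) - block_grad b i g p)
             \<le> l * block_norm B i t"
    and t: "t \<in> block_space b i"
  shows "g (p + t) \<le> g p + block_grad b i g p \<bullet> t + l / 2 * (block_norm B i t)\<^sup>2"
proof -
  \<comment> \<open>The coefficient \<open>l / 2\<close> is chosen so that the derivative of the
    last term, \<open>l * s\<close> times the squared norm of \<open>t\<close>, is exactly what the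
    Lipschitz bound at \<open>p + s *\<^sub>R t\<close> allows.\<close>
  define \<phi> where "\<phi> = (\<lambda>s::real. g (p + s *\<^sub>R t) - s * (grad g p \<bullet> t) - l / 2 * (block_norm B i t)\<^sup>2 * s\<^sup>2)"
  have "\<phi> 1 \<le> \<phi> 0"
  proof (rule DERIV_nonpos_imp_nonincreasing[of 0 1 \<phi>])
    fix s :: real assume s: "0 \<le> s" "s \<le> 1"
    let ?d = "grad g (p + s *\<^sub>R t) \<bullet> t - grad g p \<bullet> t - l * (block_norm B i t)\<^sup>2 * s"
    have "(\<phi> has_real_derivative ?d) (at s)"
      unfolding \<phi>_def
      by (auto intro!: derivative_eq_intros has_real_derivative_along_line diff simp: field_simps)
    moreover have "?d \<le> 0"
    proof -
      have st: "s *\<^sub>R t \<in> block_space b i" using t by (simp add: block_space_def)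
      let ?a = "block_grad b i g (p + s *\<^sub>R t) - block_grad b i g p"
      have a: "?a \<in> block_space b i"
        unfolding block_grad_eq blk_diff[symmetric] by (rule blk_in_block_space)
      have "grad g (p + s *\<^sub>R t) \<bullet> t - grad g p \<bullet> t = ?a \<bullet> t"
        using inner_blk[of _ b i t] by (simp add: blk_ident[OF t] block_grad_eq inner_diff_left)
      also have "\<dots> \<le> dual_block_norm b B i ?a * block_norm B i t"
        by (rule dual_block_norm_inner_le[where B = B, OF spd a])
      also have "\<dots> \<le> (l * block_norm B i (s *\<^sub>R t)) * block_norm B i t"
        using lip[OF st, of p] block_norm_nonneg[where B = B, OF spd]
        by (intro mult_right_mono) (auto simp: block_U_mult blk_ident[OF st])
      also have "\<dots> = l * (block_norm B i t)\<^sup>2 * s"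
        using s by (simp add: block_norm_scaleR power2_eq_square)
      finally show ?thesis by simp
    qed
    ultimately show "\<exists>y. (\<phi> has_real_derivative y) (at s) \<and> y \<le> 0" by blast
  qed simp
  moreover have "grad g p \<bullet> t = block_grad b i g p \<bullet> t"
    using inner_blk[of _ b i t] by (simp add: blk_ident[OF t] block_grad_eq)
  ultimately show ?thesis by (simp add: \<phi>_def)
qed

text \<open>\<open>p + h\<close> is the average over the \<open>|C|\<close> blocks that matter of the points
  \<open>p + |C| h\<^sup>(\<^sup>i\<^sup>)\<close>, so convexity reduces the estimate to single-block steps.\<close>

lemma separable_overapproximation:
  fixes b :: "'N::finite \<Rightarrow> 'n::finite"
  assumes spd: "\<And>i. spd_block b i (B i)"
    and cvx: "convex_on UNIV g"
    and diff: "\<And>p. g differentiable (at p)"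
    and dep: "depends_only_on_blocks b C g"
    and l0: "\<And>i. i \<notin> C \<Longrightarrow> l i = 0"
    and lip: "\<And>i p t. t \<in> block_space b i \<Longrightarrow>
           dual_block_norm b B i (block_grad b i g (p + block_U b i *v t) - block_grad b i g p)
             \<le> l i * block_norm B i t"
  shows "g (p + h) \<le> g p + grad g p \<bullet> h
           + (\<Sum>i\<in>UNIV. real (card C) * l i / 2 * (block_norm B i (blk b i h))\<^sup>2)"
proof -
  define hC where "hC = (\<Sum>i\<in>C. blk b i h)"
  have blkC: "blk b i hC = blk b i h" if "i \<in> C" for i
    using that by (auto simp: hC_def vec_eq_iff blk_nth)
  have ghC: "g (p + h) = g (p + hC)"
    using dep blkC by (simp add: depends_only_on_blocks_def blk_add)
  \<comment> \<open>Moving in a block outside \<open>C\<close> leaves \<open>g\<close> unchanged, so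
    the tangent inequality in both directions forces the slope to vanish.\<close>
  have off: "grad g p \<bullet> blk b i h = 0" if "i \<notin> C" for i
  proof -
    have "blk b j (c *\<^sub>R blk b i h) = 0" if "j \<in> C" for j c
      using that \<open>i \<notin> C\<close> by (auto simp: vec_eq_iff blk_nth)
    then have "g (p + c *\<^sub>R blk b i h) = g p" for c
      using dep by (simp add: depends_only_on_blocks_def blk_add)
    then show ?thesis
      using convex_above_tangent[OF cvx diff, of p "1 *\<^sub>R blk b i h"]
        convex_above_tangent[OF cvx diff, of p "(-1) *\<^sub>R blk b i h"]
      by (simp only: inner_scaleR_right)
  qed
  have gradC: "(\<Sum>i\<in>C. grad g p \<bullet> blk b i h) = grad g p \<bullet> h"
  proof -
    have "(\<Sum>i\<in>C. grad g p \<bullet> blk b i h) = (\<Sum>i\<in>UNIV. grad g p \<bullet> blk b i h)"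
      by (rule sum.mono_neutral_left) (auto simp: off)
    then show ?thesis by (simp add: inner_sum_right[symmetric] sum_blk)
  qed
  show ?thesis
  \<comment> \<open>For empty \<open>C\<close> there is nothing to average, but then
    \<open>hC = 0\<close> and by \<open>gradC\<close> the linear term is zero.\<close>
  proof (cases "C = {}")
    case True
    then show ?thesis using gradC ghC by (simp add: hC_def)
  next
    case False
    define \<omega> where "\<omega> = real (card C)"
    have \<omega>: "\<omega> > 0" using False by (simp add: \<omega>_def card_gt_0_iff)
    have "(\<Sum>i\<in>C. (1 / \<omega>) *\<^sub>R p) = p"
      using \<omega> False by (simp only: sum_constant_scaleR) (simp add: \<omega>_def)
    then have "p + hC = (\<Sum>i\<in>C. (1 / \<omega>) *\<^sub>R (p + \<omega> *\<^sub>R blk b i h))"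
      using \<omega> by (simp add: hC_def scaleR_add_right sum.distrib del: sum_constant)
    then have "g (p + hC) \<le> (\<Sum>i\<in>C. (1 / \<omega>) * g (p + \<omega> *\<^sub>R blk b i h))"
      using convex_on_sum[of C UNIV g "\<lambda>_. 1 / \<omega>"] False cvx \<omega> by (simp add: \<omega>_def)
    also have "\<dots> \<le> (\<Sum>i\<in>C. 1 / \<omega> * g p + grad g p \<bullet> blk b i h
        + \<omega> * l i / 2 * (block_norm B i (blk b i h))\<^sup>2)"
    proof (rule sum_mono)
      fix i
      have t: "\<omega> *\<^sub>R blk b i h \<in> block_space b i"
        using blk_in_block_space[of b i h] by (simp add: block_space_def)
      \<comment> \<open>A step \<open>\<omega>\<close> times too long costs \<omega>^2 in the
        quadratic term and the averaging weight returns 1/\<omega>; the net factor is the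
        \<open>card C\<close> of the statement.\<close>
      have "g (p + \<omega> *\<^sub>R blk b i h) \<le> g p + \<omega> * (grad g p \<bullet> blk b i h)
          + l i / 2 * (\<omega>\<^sup>2 * (block_norm B i (blk b i h))\<^sup>2)"
        using block_descent[OF spd diff lip t, of p] inner_blk[of "grad g p" b i h] \<omega>
        by (simp add: block_norm_scaleR block_grad_eq power_mult_distrib)
      then have "(1 / \<omega>) * g (p + \<omega> *\<^sub>R blk b i h) \<le> (1 / \<omega>) * (g p + \<omega> * (grad g p \<bullet> blk b i h)
          + l i / 2 * (\<omega>\<^sup>2 * (block_norm B i (blk b i h))\<^sup>2))"
        using \<omega> by (intro mult_left_mono) auto
      also have "\<dots> = 1 / \<omega> * g p + grad g p \<bullet> blk b i h + \<omega> * l i / 2 * (block_norm B i (blk b i h))\<^sup>2"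
        using \<omega> by (simp add: field_simps power2_eq_square)
      finally show "(1 / \<omega>) * g (p + \<omega> *\<^sub>R blk b i h) \<le> \<dots>" .
    qed
    also have "\<dots> = g p + grad g p \<bullet> h + (\<Sum>i\<in>C. \<omega> * l i / 2 * (block_norm B i (blk b i h))\<^sup>2)"
      using \<omega> False by (simp add: sum.distrib gradC \<omega>_def)
    also have "(\<Sum>i\<in>C. \<omega> * l i / 2 * (block_norm B i (blk b i h))\<^sup>2)
        = (\<Sum>i\<in>UNIV. \<omega> * l i / 2 * (block_norm B i (blk b i h))\<^sup>2)"
      by (rule sum.mono_neutral_left) (auto simp: l0)
    finally show ?thesis by (simp add: ghC \<omega>_def)
  qed
qed

section \<open>Accelerated proximal steps\<close>

text \<open>\<open>real_of_ereal\<close> sends infinity to 0, so convexity passes to real values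
  only on the effective domain, which must itself be shown convex.\<close>

lemma convex_on_real_of_ereal:
  assumes "ereal_convex_on S g"
  shows "convex_on {s \<in> S. g s < \<infinity>} (\<lambda>s. real_of_ereal (g s))"
proof (rule convex_onI)
  note cvx = assms[unfolded ereal_convex_on_def]
  have key: "(1 - u) *\<^sub>R s + u *\<^sub>R t \<in> S"
    "g ((1 - u) *\<^sub>R s + u *\<^sub>R t) \<le> ereal ((1 - u) * real_of_ereal (g s) + u * real_of_ereal (g t))"
    if "s \<in> S" "t \<in> S" "g s < \<infinity>" "g t < \<infinity>" "0 \<le> u" "u \<le> 1" for u s t
  proof -
    show "(1 - u) *\<^sub>R s + u *\<^sub>R t \<in> S" using cvx that by (auto intro!: convexD_alt)
    have "g s = ereal (real_of_ereal (g s))" "g t = ereal (real_of_ereal (g t))"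
      using cvx that by (auto simp: ereal_real)
    moreover have "g ((1 - u) *\<^sub>R s + u *\<^sub>R t) \<le> ereal (1 - u) * g s + ereal u * g t"
      using cvx that by auto
    ultimately show "g ((1 - u) *\<^sub>R s + u *\<^sub>R t)
        \<le> ereal ((1 - u) * real_of_ereal (g s) + u * real_of_ereal (g t))"
      by (metis plus_ereal.simps(1) times_ereal.simps(1))
  qed
  show "convex {s \<in> S. g s < \<infinity>}"
    unfolding convex_alt
  proof (intro ballI allI impI)
    fix s t and u :: real
    assume "s \<in> {s \<in> S. g s < \<infinity>}" "t \<in> {s \<in> S. g s < \<infinity>}" "0 \<le> u \<and> u \<le> 1"
    then show "(1 - u) *\<^sub>R s + u *\<^sub>R t \<in> {s \<in> S. g s < \<infinity>}"
      using key[of s t u] by (auto intro: le_less_trans)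
  qed
  fix u :: real and s t
  assume "0 < u" "u < 1" "s \<in> {s \<in> S. g s < \<infinity>}" "t \<in> {s \<in> S. g s < \<infinity>}"
  then have k: "(1 - u) *\<^sub>R s + u *\<^sub>R t \<in> S"
    "g ((1 - u) *\<^sub>R s + u *\<^sub>R t) \<le> ereal ((1 - u) * real_of_ereal (g s) + u * real_of_ereal (g t))"
    using key[of s t u] by auto
  then have "g ((1 - u) *\<^sub>R s + u *\<^sub>R t) \<noteq> - \<infinity>" using cvx by auto
  then show "real_of_ereal (g ((1 - u) *\<^sub>R s + u *\<^sub>R t))
      \<le> (1 - u) * real_of_ereal (g s) + u * real_of_ereal (g t)"
    using k(2) by (cases "g ((1 - u) *\<^sub>R s + u *\<^sub>R t)") auto
qed

text \<open>The quadratic term makes the objective grow quadratically away from its minimizer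
  \<open>z\<close>; the extra term in \<open>u - z\<close> on the left records this and later
  becomes D_{k+1}.\<close>

lemma prox_three_point:
  fixes A :: "real^'N^'N"
  defines "q \<equiv> \<lambda>t. (A *v t) \<bullet> t"
  assumes sym: "transpose A = A" and cvx: "convex_on S p" and z: "z \<in> S" and u: "u \<in> S"
    and min: "\<And>t. t \<in> S \<Longrightarrow> d \<bullet> z + c / 2 * q (z - w) + p z \<le> d \<bullet> t + c / 2 * q (t - w) + p t"
  shows "d \<bullet> z + c / 2 * q (z - w) + c / 2 * q (u - z) + p z \<le> d \<bullet> u + c / 2 * q (u - w) + p u"
proof -
  define e where "e = (A *v (z - w)) \<bullet> (u - z)"
  \<comment> \<open>An upper bound for the slope of the objective at \<open>z\<close> towards
    \<open>u\<close>, with \<open>p\<close> replaced by its chord. Minimality against points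
    \<open>z + s *\<^sub>R (u - z)\<close> gives \<open>0 \<le> a\<close> as \<open>s\<close> tends
    to 0.\<close>
  define a where "a = d \<bullet> (u - z) + c * e + p u - p z"
  have q_along: "q (z + s *\<^sub>R (u - z) - w) = q (z - w) + 2 * s * e + s\<^sup>2 * q (u - z)" for s
  proof -
    have "q (g + s *\<^sub>R h) = q g + 2 * s * ((A *v g) \<bullet> h) + s\<^sup>2 * q h" for g h
      using symmetric_matrix_inner[OF sym, of h g]
      by (simp add: q_def algebra_simps inner_add_left inner_add_right power2_eq_square)
    from this[of "z - w" "u - z"] show ?thesis by (simp add: e_def algebra_simps)
  qed
  have opt: "0 \<le> a + s * (c / 2 * q (u - z))" if "0 < s" "s \<le> 1" for s
  proof -
    have eq: "z + s *\<^sub>R (u - z) = (1 - s) *\<^sub>R z + s *\<^sub>R u" by (simp add: algebra_simps)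
    have "z + s *\<^sub>R (u - z) \<in> S" "p (z + s *\<^sub>R (u - z)) \<le> (1 - s) * p z + s * p u"
      unfolding eq using cvx z u that by (auto simp: convex_on_def intro!: convexD_alt convex_onD[OF cvx])
    then have "d \<bullet> z + c / 2 * q (z - w) + p z
        \<le> d \<bullet> z + s * (d \<bullet> (u - z)) + c / 2 * (q (z - w) + 2 * s * e + s\<^sup>2 * q (u - z))
          + ((1 - s) * p z + s * p u)"
      using min[of "z + s *\<^sub>R (u - z)"] unfolding q_along inner_add_right inner_scaleR_right by linarith
    then have "0 \<le> s * (a + s * (c / 2 * q (u - z)))"
      by (simp add: a_def algebra_simps power2_eq_square)
    then show ?thesis using that by (simp add: zero_le_mult_iff)
  qed
  have "((\<lambda>s. a + s * (c / 2 * q (u - z))) \<longlongrightarrow> a + 0 * (c / 2 * q (u - z))) (at_right 0)"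
    by (intro tendsto_intros)
  moreover have "\<forall>\<^sub>F s in at_right 0. 0 \<le> a + s * (c / 2 * q (u - z))"
    unfolding eventually_at_right_field using opt by (intro exI[of _ 1]) auto
  ultimately have "0 \<le> a" using tendsto_lowerbound[of _ a] by fastforce
  then show ?thesis using q_along[of 1] by (simp add: a_def inner_diff_right algebra_simps)
qed

section \<open>Step sizes and the telescoped rate\<close>

text \<open>The recursion is equivalent to \<open>\<theta>\<^sub>k\<^sub>+\<^sub>1\<^sup>2 = (1 - \<theta>\<^sub>k\<^sub>+\<^sub>1) \<theta>\<^sub>k\<^sup>2\<close>, which makes the weighted
  gaps \<open>a\<^sub>k\<^sub>+\<^sub>1 / \<theta>\<^sub>k\<^sup>2\<close> telescope.\<close>

lemma
  fixes \<theta> :: "nat \<Rightarrow> real"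
  assumes \<theta>0: "\<theta> 0 = 1"
    and rec: "\<And>k. \<theta> (Suc k) = (sqrt (\<theta> k ^ 4 + 4 * (\<theta> k)\<^sup>2) - (\<theta> k)\<^sup>2) / 2"
  shows theta_pos: "0 < \<theta> k"
    and theta_le: "\<theta> k \<le> 2 / (real k + 2)"
    and theta_square: "(\<theta> (Suc k))\<^sup>2 = (1 - \<theta> (Suc k)) * (\<theta> k)\<^sup>2"
proof -
  have sq: "(\<theta> (Suc k))\<^sup>2 = (1 - \<theta> (Suc k)) * (\<theta> k)\<^sup>2" for k
  proof -
    \<comment> \<open>The recursion picks the positive root of t^2 + \<theta>_k^2 t - \<theta>_k^2 =
      0.\<close>
    define r where "r = sqrt (\<theta> k ^ 4 + 4 * (\<theta> k)\<^sup>2)"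
    have "r\<^sup>2 = (\<theta> k)\<^sup>2 * (\<theta> k)\<^sup>2 + 4 * (\<theta> k)\<^sup>2"
      by (simp add: r_def flip: power_add)
    then show ?thesis unfolding rec r_def[symmetric]
      by (simp add: field_simps power2_eq_square)
  qed
  have pos: "0 < \<theta> k" for k
  proof (induction k)
    case (Suc k)
    have "(\<theta> k)\<^sup>2 = sqrt (\<theta> k ^ 4)"
      by (rule real_sqrt_unique[symmetric]) (simp_all flip: power_mult)
    also have "\<dots> < sqrt (\<theta> k ^ 4 + 4 * (\<theta> k)\<^sup>2)" using Suc by simp
    finally show ?case by (simp add: rec)
  qed (simp add: \<theta>0)
  show "(\<theta> (Suc k))\<^sup>2 = (1 - \<theta> (Suc k)) * (\<theta> k)\<^sup>2" "0 < \<theta> k" by (rule sq, rule pos)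
  show "\<theta> k \<le> 2 / (real k + 2)"
  proof (induction k)
    case (Suc k)
    show ?case
    proof (rule ccontr)
      \<comment> \<open>A larger \<open>\<theta> (Suc k)\<close> shrinks the factor
        \<open>1 - \<theta> (Suc k)\<close> in its own square, so exceeding the bound is
        self-defeating; what remains is (k+1)(k+3) \<le> (k+2)^2.\<close>
      assume "\<not> \<theta> (Suc k) \<le> 2 / (real (Suc k) + 2)"
      then have gt: "2 / (real k + 3) < \<theta> (Suc k)" by (simp add: add.commute)
      then have le: "1 - \<theta> (Suc k) \<le> (real k + 1) / (real k + 3)" by (simp add: field_simps)
      have "(2 / (real k + 3))\<^sup>2 < (\<theta> (Suc k))\<^sup>2" using gt by (intro power_strict_mono) auto
      also have "\<dots> \<le> (real k + 1) / (real k + 3) * (\<theta> k)\<^sup>2"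
        unfolding sq by (intro mult_right_mono le) auto
      also have "\<dots> \<le> (real k + 1) / (real k + 3) * (2 / (real k + 2))\<^sup>2"
        using Suc pos[of k] by (intro mult_left_mono power_mono) auto
      also have "\<dots> = 4 * ((real k + 1) * (real k + 3)) / ((real k + 3)\<^sup>2 * (real k + 2)\<^sup>2)"
        by (simp add: divide_simps power2_eq_square)
      also have "\<dots> \<le> 4 * (real k + 2)\<^sup>2 / ((real k + 3)\<^sup>2 * (real k + 2)\<^sup>2)"
        by (intro divide_right_mono) (auto simp: power2_eq_square algebra_simps)
      also have "\<dots> = (2 / (real k + 3))\<^sup>2" by (simp add: power_divide)
      finally show False by simp
    qed
  qed (simp add: \<theta>0)
qed

lemma accelerated_rate:
  fixes a D \<theta> :: "nat \<Rightarrow> real"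
  assumes \<theta>0: "\<theta> 0 = 1"
    and rec: "\<And>k. \<theta> (Suc k) = (sqrt (\<theta> k ^ 4 + 4 * (\<theta> k)\<^sup>2) - (\<theta> k)\<^sup>2) / 2"
    and step: "\<And>k. a (Suc k) \<le> (1 - \<theta> k) * a k + (\<theta> k)\<^sup>2 / 2 * (D k - D (Suc k))"
    and D: "\<And>k. D k \<ge> 0"
  shows "a (Suc k) \<le> 2 / (real k + 2)\<^sup>2 * D 0"
proof -
  note facts = theta_pos[OF \<theta>0 rec] theta_le[OF \<theta>0 rec] theta_square[OF \<theta>0 rec]
  \<comment> \<open>Keeping the \<open>D (Suc k)\<close> term closes the induction: after
    multiplication by \<open>1 - \<theta> (Suc k)\<close> it cancels against the one in
    \<open>step\<close>. In the base case \<open>\<theta> 0 = 1\<close> erases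
    \<open>a 0\<close>.\<close>
  have "a (Suc k) + (\<theta> k)\<^sup>2 / 2 * D (Suc k) \<le> (\<theta> k)\<^sup>2 / 2 * D 0"
  proof (induction k)
    case 0
    then show ?case using step[of 0] by (simp add: \<theta>0 field_simps)
  next
    case (Suc k)
    have "1 - \<theta> (Suc k) \<ge> 0"
      using facts(2)[of "Suc k"] by (smt (verit) divide_le_eq_1_pos of_nat_0_le_iff)
    then have "(1 - \<theta> (Suc k)) * (a (Suc k) + (\<theta> k)\<^sup>2 / 2 * D (Suc k))
        \<le> (1 - \<theta> (Suc k)) * ((\<theta> k)\<^sup>2 / 2 * D 0)"
      using Suc by (rule mult_left_mono[rotated])
    then have "(1 - \<theta> (Suc k)) * a (Suc k) + (\<theta> (Suc k))\<^sup>2 / 2 * D (Suc k) \<le> (\<theta> (Suc k))\<^sup>2 / 2 * D 0"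
      by (simp add: facts(3) distrib_left)
    then show ?case using step[of "Suc k"] by (simp add: right_diff_distrib)
  qed
  moreover have "(\<theta> k)\<^sup>2 / 2 * D (Suc k) \<ge> 0" using D by simp
  moreover have "(\<theta> k)\<^sup>2 / 2 * D 0 \<le> (2 / (real k + 2))\<^sup>2 / 2 * D 0"
    using D facts(1,2)[of k] by (intro mult_right_mono divide_right_mono power_mono) (auto simp: less_imp_le)
  ultimately show ?thesis by (simp add: power_divide)
qed

text \<open>With n blocks, \<open>omega_bar\<close> is T/S, \<open>L_bar\<close> is S/n and
  \<open>norm_weight\<close> is (n/T) v, so all normalizations cancel.\<close>

lemma weighted_norm_constant:
  fixes C :: "'m::finite \<Rightarrow> 'n::finite set" and L :: "'m \<Rightarrow> 'n \<Rightarrow> real"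
    and b :: "'N::finite \<Rightarrow> 'n"
  defines "v \<equiv> \<lambda>i. \<Sum>j\<in>UNIV. real (card (C j)) * L j i"
  assumes spd: "\<And>i. spd_block b i (B i)" and L: "\<And>j i. L j i \<ge> 0" and v: "\<And>i. v i > 0"
  shows "omega_bar C L * L_bar L * (weighted_norm b B (norm_weight C L) h)\<^sup>2
    = (\<Sum>i\<in>UNIV. v i * (block_norm B i (blk b i h))\<^sup>2)"
proof -
  define S T where "S = (\<Sum>j\<in>UNIV. \<Sum>i\<in>UNIV. L j i)"
    and "T = (\<Sum>j\<in>UNIV. \<Sum>l\<in>UNIV. real (card (C j)) * L j l)"
  define n where "n = real CARD('n)"
  have n: "n > 0" by (simp add: n_def)
  have "T = (\<Sum>i\<in>UNIV. v i)" unfolding T_def v_def by (rule sum.swap)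
  then have T: "T > 0" using v by (simp add: sum_pos)
  \<comment> \<open>Cancelling S needs it nonzero: if all \<open>L j i\<close> vanished, so would T,
    contrary to \<open>v i > 0\<close>.\<close>
  have S: "S \<noteq> 0"
  proof
    assume "S = 0"
    then have "L j i = 0" for i j
      by (simp add: S_def sum_nonneg_eq_0_iff sum_nonneg L)
    then show False using T by (simp add: T_def)
  qed
  have om: "omega_bar C L = T / S"
    by (simp add: omega_bar_def T_def S_def sum_divide_distrib sum_distrib_left)
  have w: "norm_weight C L i = n / T * v i" for i
    by (simp add: norm_weight_def n_def T_def v_def)
  have "(weighted_norm b B (norm_weight C L) h)\<^sup>2
      = (\<Sum>i\<in>UNIV. norm_weight C L i * (block_norm B i (blk b i h))\<^sup>2)"
    unfolding weighted_norm_def w using n T v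
    by (intro real_sqrt_pow2 sum_nonneg mult_nonneg_nonneg) (auto simp: less_imp_le)
  also have "\<dots> = n / T * (\<Sum>i\<in>UNIV. v i * (block_norm B i (blk b i h))\<^sup>2)"
    by (simp add: w sum_distrib_left mult.assoc)
  finally show ?thesis
    using n S T by (simp add: om L_bar_def flip: S_def n_def)
qed

theorem mainTheorem3:
  fixes b :: "'N::finite \<Rightarrow> 'n::finite"
    and B :: "'n \<Rightarrow> real^'N^'N"
    and fs :: "'m::finite \<Rightarrow> real^'N \<Rightarrow> real"
    and C :: "'m \<Rightarrow> 'n set"
    and L :: "'m \<Rightarrow> 'n \<Rightarrow> real"
    and \<psi> :: "'n \<Rightarrow> real^'N \<Rightarrow> ereal"
    and f :: "real^'N \<Rightarrow> real"
    and F :: "real^'N \<Rightarrow> ereal"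
    and v :: "'n \<Rightarrow> real"
    and x y z :: "nat \<Rightarrow> real^'N"
    and \<theta> :: "nat \<Rightarrow> real"
    and xstar :: "real^'N"
    and k :: nat
  assumes "\<And>i. spd_block b i (B i)"
    and "\<And>j. convex_on UNIV (fs j)"
    and "\<And>j. fs j differentiable_on UNIV"
    and "\<And>j. depends_only_on_blocks b (C j) (fs j)"
    and "\<And>j i. L j i \<ge> 0"
    and "\<And>j i. i \<notin> C j \<Longrightarrow> L j i = 0"
    and "\<And>i j p t. t \<in> block_space b i \<Longrightarrow>
           dual_block_norm b B i
             (block_grad b i (fs j) (p + block_U b i *v t) - block_grad b i (fs j) p)
             \<le> L j i * block_norm B i t"
    and "\<And>i. ereal_convex_on (block_space b i) (\<psi> i)"
    and "f = (\<lambda>p. \<Sum>j\<in>UNIV. fs j p)"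
    and "F = (\<lambda>p. ereal (f p) + separable b \<psi> p)"
    and "v = (\<lambda>i. \<Sum>j\<in>UNIV. real (card (C j)) * L j i)"
    and "\<And>i. v i > 0"
    and "separable b \<psi> (x 0) < \<infinity>"
    and "is_arg_min F (\<lambda>_. True) xstar"
    and "approx_run b B f \<psi> v x y z \<theta>"
    and "k \<ge> 1"
  shows "F (x k) - F xstar
           \<le> ereal (2 * omega_bar C L * L_bar L / (real k + 1)\<^sup>2
                * (weighted_norm b B (norm_weight C L) (x 0 - xstar))\<^sup>2)"
proof -
  note spd = assms(1) and L = assms(5) and f = assms(9) and F = assms(10)
    and v = assms(11) and vpos = assms(12)
  note run = assms(15)[unfolded approx_run_def]
  define Q where "Q h = (\<Sum>i\<in>UNIV. v i * (block_norm B i (blk b i h))\<^sup>2)" for h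
  \<comment> \<open>\<open>Dm i\<close> is the effective domain of the i-th regularizer; the
    real-valued \<open>p\<close> and \<open>P\<close> are meaningful only there.\<close>
  define Dm where "Dm i = {t \<in> block_space b i. \<psi> i t < \<infinity>}" for i
  define p where "p i t = real_of_ereal (\<psi> i t)" for i t
  define P where "P h = (\<Sum>i\<in>UNIV. p i (blk b i h))" for h

  have Q_nonneg: "Q h \<ge> 0" for h
    unfolding Q_def using vpos by (intro sum_nonneg mult_nonneg_nonneg) (auto simp: less_imp_le)
  have Q_scale: "Q (c *\<^sub>R h) = c\<^sup>2 * Q h" for c h
    by (simp add: Q_def blk_scaleR block_norm_scaleR power_mult_distrib sum_distrib_left mult.left_commute)

  \<comment> \<open>Passing to real values on the effective domains\<close>
  have p_convex: "convex_on (Dm i) (p i)" for i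
    unfolding Dm_def p_def[abs_def] by (rule convex_on_real_of_ereal) (rule assms(8))
  have \<psi>_not_minf: "\<psi> i t \<noteq> - \<infinity>" if "t \<in> block_space b i" for i t
    using assms(8)[of i] that by (auto simp: ereal_convex_on_def)
  have \<psi>_real: "\<psi> i t = ereal (p i t)" if "t \<in> Dm i" for i t
    using that \<psi>_not_minf[of t i] by (auto simp: Dm_def p_def ereal_real)
  have F_real: "F h = ereal (f h + P h)" if "\<And>i. blk b i h \<in> Dm i" for h
    by (simp add: F separable_def P_def \<psi>_real[OF that])
  have in_Dm: "blk b i h \<in> Dm i" if "separable b \<psi> h < \<infinity>" for h i
    using that sum_Pinfty[of "\<lambda>i. \<psi> i (blk b i h)" UNIV]
    by (auto simp: separable_def Dm_def blk_in_block_space less_top[symmetric])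

  have x0: "blk b i (x 0) \<in> Dm i" for i using in_Dm assms(13) by blast
  \<comment> \<open>Comparison with the feasible point \<open>x 0\<close> makes the minimal value
    finite, hence every block of \<open>xstar\<close> feasible.\<close>
  have "F xstar \<le> F (x 0)" using assms(14) by (simp add: is_arg_min_linorder)
  also have "\<dots> < \<infinity>" using F_real[OF x0] by simp
  finally have "separable b \<psi> xstar < \<infinity>" by (auto simp: F less_top[symmetric])
  then have xstar: "blk b i xstar \<in> Dm i" for i using in_Dm by blast

  \<comment> \<open>Smooth part: gradient, convexity and upper bound\<close>
  have fs_diff: "fs j differentiable (at q)" for j q
    using assms(3)[of j] by (simp add: differentiable_on_def)
  have f_diff: "f differentiable (at q)" for q
    unfolding f by (intro differentiable_sum) (auto intro: fs_diff)
  have f_convex: "convex_on UNIV f"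
  proof (rule convex_onI)
    fix u :: real and s t assume "0 < u" "u < 1"
    then have "f ((1 - u) *\<^sub>R s + u *\<^sub>R t) \<le> (\<Sum>j\<in>UNIV. (1 - u) * fs j s + u * fs j t)"
      unfolding f by (intro sum_mono convex_onD[OF assms(2)]) auto
    then show "f ((1 - u) *\<^sub>R s + u *\<^sub>R t) \<le> (1 - u) * f s + u * f t"
      by (simp add: f sum.distrib sum_distrib_left)
  qed simp
  have grad_f: "grad f q \<bullet> h = (\<Sum>j\<in>UNIV. grad (fs j) q \<bullet> h)" for q h
  proof -
    have "(f has_derivative (\<lambda>h. \<Sum>j\<in>UNIV. grad (fs j) q \<bullet> h)) (at q)"
      unfolding f by (intro has_derivative_sum has_derivative_grad fs_diff)
    from has_derivative_unique[OF has_derivative_grad[OF f_diff] this] show ?thesis by metis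
  qed
  have f_upper: "f (q + h) \<le> f q + grad f q \<bullet> h + Q h / 2" for q h
  proof -
    have "f (q + h) \<le> (\<Sum>j\<in>UNIV. fs j q + grad (fs j) q \<bullet> h
        + (\<Sum>i\<in>UNIV. real (card (C j)) * L j i / 2 * (block_norm B i (blk b i h))\<^sup>2))"
      unfolding f by (intro sum_mono separable_overapproximation assms(1,2,4,6,7) fs_diff)
    also have "\<dots> = f q + grad f q \<bullet> h
        + (\<Sum>j\<in>UNIV. \<Sum>i\<in>UNIV. real (card (C j)) * L j i / 2 * (block_norm B i (blk b i h))\<^sup>2)"
      by (simp add: sum.distrib grad_f fun_cong[OF f])
    also have "(\<Sum>j\<in>UNIV. \<Sum>i\<in>UNIV. real (card (C j)) * L j i / 2 * (block_norm B i (blk b i h))\<^sup>2) = Q h / 2"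
      by (subst sum.swap) (simp add: Q_def v sum_divide_distrib sum_distrib_right)
    finally show ?thesis .
  qed

  \<comment> \<open>Iterates and their feasibility\<close>
  have \<theta>0: "\<theta> 0 = 1"
    and \<theta>_rec: "\<theta> (Suc k) = (sqrt (\<theta> k ^ 4 + 4 * (\<theta> k)\<^sup>2) - (\<theta> k)\<^sup>2) / 2" for k
    using run by auto
  have \<theta>_pos: "0 < \<theta> k" and \<theta>_le1: "\<theta> k \<le> 1" for k
  proof -
    show "0 < \<theta> k" by (rule theta_pos[OF \<theta>0 \<theta>_rec])
    have "\<theta> k \<le> 2 / (real k + 2)" by (rule theta_le[OF \<theta>0 \<theta>_rec])
    also have "\<dots> \<le> 1" by simp
    finally show "\<theta> k \<le> 1" .
  qed
  have y: "y k = (1 - \<theta> k) *\<^sub>R x k + \<theta> k *\<^sub>R z k" for k using run by auto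
  \<comment> \<open>Eliminating \<open>y\<close> exhibits a convex combination of \<open>x k\<close>
    and \<open>z (Suc k)\<close>; this gives feasibility and lets convexity of \<open>P\<close> use
    the same weights as the smooth part.\<close>
  have x_Suc: "x (Suc k) = (1 - \<theta> k) *\<^sub>R x k + \<theta> k *\<^sub>R z (Suc k)" for k
  proof -
    have "x (Suc k) = y k + \<theta> k *\<^sub>R (z (Suc k) - z k)" using run by blast
    then show ?thesis by (simp add: y algebra_simps)
  qed

  have z_min: "blk b i (z (Suc k)) \<in> Dm i"
    "t \<in> Dm i \<Longrightarrow> block_grad b i f (y k) \<bullet> blk b i (z (Suc k))
        + \<theta> k * v i / 2 * (block_norm B i (blk b i (z (Suc k)) - blk b i (z k)))\<^sup>2 + p i (blk b i (z (Suc k)))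
      \<le> block_grad b i f (y k) \<bullet> t
        + \<theta> k * v i / 2 * (block_norm B i (t - blk b i (z k)))\<^sup>2 + p i t" for i k t
  proof -
    define h where "h t = block_grad b i f (y k) \<bullet> (t - blk b i (y k))
      + \<theta> k * v i / 2 * (block_norm B i (t - blk b i (z k)))\<^sup>2" for t
    have min: "ereal (h (blk b i (z (Suc k)))) + \<psi> i (blk b i (z (Suc k))) \<le> ereal (h t) + \<psi> i t"
      if "t \<in> block_space b i" for t
      using run that unfolding is_arg_min_linorder h_def by blast
    \<comment> \<open>The feasible competitor \<open>x 0\<close> makes the minimal value finite, so
      the minimizer lies in \<open>Dm i\<close>.\<close>
    have "ereal (h (blk b i (z (Suc k)))) + \<psi> i (blk b i (z (Suc k)))
        \<le> ereal (h (blk b i (x 0)) + p i (blk b i (x 0)))"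
      using min[OF blk_in_block_space, of "x 0"] \<psi>_real[OF x0, of i] by simp
    then show zD: "blk b i (z (Suc k)) \<in> Dm i"
      by (auto simp: Dm_def blk_in_block_space less_top[symmetric])
    assume t: "t \<in> Dm i"
    then have "h (blk b i (z (Suc k))) + p i (blk b i (z (Suc k))) \<le> h t + p i t"
      using min[of t] \<psi>_real[OF zD] \<psi>_real[OF t] by (simp add: Dm_def)
    then show "block_grad b i f (y k) \<bullet> blk b i (z (Suc k))
        + \<theta> k * v i / 2 * (block_norm B i (blk b i (z (Suc k)) - blk b i (z k)))\<^sup>2 + p i (blk b i (z (Suc k)))
      \<le> block_grad b i f (y k) \<bullet> t
        + \<theta> k * v i / 2 * (block_norm B i (t - blk b i (z k)))\<^sup>2 + p i t"
      by (simp add: h_def inner_diff_right)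
  qed

  have x_dom: "blk b i (x k) \<in> Dm i" for i k
  proof (induction k)
    case (Suc k)
    have "convex (Dm i)" using p_convex by (simp add: convex_on_def)
    then show ?case
      using Suc z_min(1) \<theta>_pos[of k] \<theta>_le1[of k]
      by (auto simp: x_Suc blk_add blk_scaleR intro!: convexD_alt)
  qed (rule x0)

  \<comment> \<open>One accelerated proximal step\<close>
  have prox: "grad f (y k) \<bullet> z (Suc k) + \<theta> k / 2 * Q (z (Suc k) - z k)
      + \<theta> k / 2 * Q (xstar - z (Suc k)) + P (z (Suc k))
    \<le> grad f (y k) \<bullet> xstar + \<theta> k / 2 * Q (xstar - z k) + P xstar" for k
  proof -
    have "block_grad b i f (y k) \<bullet> blk b i (z (Suc k))
        + \<theta> k * v i / 2 * (block_norm B i (blk b i (z (Suc k)) - blk b i (z k)))\<^sup>2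
        + \<theta> k * v i / 2 * (block_norm B i (blk b i xstar - blk b i (z (Suc k))))\<^sup>2
        + p i (blk b i (z (Suc k)))
      \<le> block_grad b i f (y k) \<bullet> blk b i xstar
        + \<theta> k * v i / 2 * (block_norm B i (blk b i xstar - blk b i (z k)))\<^sup>2
        + p i (blk b i xstar)" for i
      using prox_three_point[of "B i" "Dm i" "p i" "blk b i (z (Suc k))" "blk b i xstar"
          "block_grad b i f (y k)" "\<theta> k * v i" "blk b i (z k)"]
        spd[of i] p_convex z_min[where k = k and i = i] xstar
      by (simp add: spd_block_def block_norm_squared[where B = B, OF spd])
    then have "(\<Sum>i\<in>UNIV. block_grad b i f (y k) \<bullet> blk b i (z (Suc k))
        + \<theta> k * v i / 2 * (block_norm B i (blk b i (z (Suc k)) - blk b i (z k)))\<^sup>2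
        + \<theta> k * v i / 2 * (block_norm B i (blk b i xstar - blk b i (z (Suc k))))\<^sup>2
        + p i (blk b i (z (Suc k))))
      \<le> (\<Sum>i\<in>UNIV. block_grad b i f (y k) \<bullet> blk b i xstar
        + \<theta> k * v i / 2 * (block_norm B i (blk b i xstar - blk b i (z k)))\<^sup>2
        + p i (blk b i xstar))"
      by (intro sum_mono)
    then show ?thesis
      by (simp add: sum.distrib Q_def P_def sum_distrib_left blk_diff block_grad_eq
          inner_sum_blk[of "grad f (y k)" _ b] mult.assoc)
  qed

  have step: "f (x (Suc k)) + P (x (Suc k)) - (f xstar + P xstar)
    \<le> (1 - \<theta> k) * (f (x k) + P (x k) - (f xstar + P xstar))
      + (\<theta> k)\<^sup>2 / 2 * (Q (xstar - z k) - Q (xstar - z (Suc k)))" for k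
  proof -
    let ?g = "grad f (y k)" and ?\<theta> = "\<theta> k"
    note \<theta> = \<theta>_pos[of k] \<theta>_le1[of k]
    have "x (Suc k) = y k + ?\<theta> *\<^sub>R (z (Suc k) - z k)"
      by (simp add: x_Suc y algebra_simps)
    then have "f (x (Suc k)) \<le> f (y k) + ?g \<bullet> (?\<theta> *\<^sub>R (z (Suc k) - z k)) + ?\<theta>\<^sup>2 / 2 * Q (z (Suc k) - z k)"
      using f_upper[of "y k" "?\<theta> *\<^sub>R (z (Suc k) - z k)"] by (simp add: Q_scale)
    \<comment> \<open>Splitting the displacement around \<open>y k\<close> separates the linear
      model into its values at \<open>x k\<close> and \<open>z (Suc k)\<close>: the first is below
      \<open>f (x k)\<close> by convexity, the second is handled by \<open>prox\<close>.\<close>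
    also have "?\<theta> *\<^sub>R (z (Suc k) - z k) = (1 - ?\<theta>) *\<^sub>R (x k - y k) + ?\<theta> *\<^sub>R (z (Suc k) - y k)"
      by (simp add: y algebra_simps)
    finally have 1: "f (x (Suc k)) \<le> (1 - ?\<theta>) * (f (y k) + ?g \<bullet> (x k - y k))
        + ?\<theta> * (f (y k) + ?g \<bullet> (z (Suc k) - y k) + ?\<theta> / 2 * Q (z (Suc k) - z k))"
      by (simp add: inner_add_right algebra_simps power2_eq_square)
    have 2: "(1 - ?\<theta>) * (f (y k) + ?g \<bullet> (x k - y k)) \<le> (1 - ?\<theta>) * f (x k)"
      using convex_above_tangent[OF f_convex f_diff, of "y k" "x k - y k"] \<theta>
      by (intro mult_left_mono) auto
    have 3: "P (x (Suc k)) \<le> (1 - ?\<theta>) * P (x k) + ?\<theta> * P (z (Suc k))"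
    proof -
      have "P (x (Suc k)) \<le> (\<Sum>i\<in>UNIV. (1 - ?\<theta>) * p i (blk b i (x k)) + ?\<theta> * p i (blk b i (z (Suc k))))"
        unfolding P_def x_Suc blk_add blk_scaleR
        using \<theta> by (intro sum_mono convex_onD[OF p_convex] x_dom z_min(1)) auto
      then show ?thesis by (simp add: P_def sum.distrib sum_distrib_left)
    qed
    have "f (y k) + ?g \<bullet> (xstar - y k) \<le> f xstar"
      using convex_above_tangent[OF f_convex f_diff, of "y k" "xstar - y k"] by simp
    \<comment> \<open>\<open>prox\<close> compares the linear model at \<open>z (Suc k)\<close> with
      that at \<open>xstar\<close>, and the tangent inequality bounds the latter by
      \<open>f xstar\<close>.\<close>
    then have "f (y k) + ?g \<bullet> (z (Suc k) - y k) + ?\<theta> / 2 * Q (z (Suc k) - z k) + P (z (Suc k))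
        \<le> f xstar + P xstar + ?\<theta> / 2 * (Q (xstar - z k) - Q (xstar - z (Suc k)))"
      using prox[of k] by (simp add: inner_diff_right algebra_simps)
    then have "?\<theta> * (f (y k) + ?g \<bullet> (z (Suc k) - y k) + ?\<theta> / 2 * Q (z (Suc k) - z k) + P (z (Suc k)))
        \<le> ?\<theta> * (f xstar + P xstar + ?\<theta> / 2 * (Q (xstar - z k) - Q (xstar - z (Suc k))))"
      using \<theta> by (intro mult_left_mono) auto
    with 1 2 3 show ?thesis by (simp add: algebra_simps power2_eq_square)
  qed

  \<comment> \<open>Rate and constants\<close>
  obtain k' where k': "k = Suc k'" using assms(16) by (cases k) auto
  \<comment> \<open>The k-th iterate is governed by \<open>\<theta> k'\<close> with k' = k - 1, so
    its bound 2/(k'+2) is the 2/(k+1) of the claim.\<close>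
  have "f (x k) + P (x k) - (f xstar + P xstar) \<le> 2 / (real k' + 2)\<^sup>2 * Q (xstar - z 0)"
    unfolding k' using accelerated_rate[OF \<theta>0 \<theta>_rec step Q_nonneg] .
  also have "Q (xstar - z 0) = Q (x 0 - xstar)"
    using run Q_scale[of "-1" "x 0 - xstar"] by simp
  also have "2 / (real k' + 2)\<^sup>2 * Q (x 0 - xstar)
      = 2 * omega_bar C L * L_bar L / (real k + 1)\<^sup>2 * (weighted_norm b B (norm_weight C L) (x 0 - xstar))\<^sup>2"
    using weighted_norm_constant[of b B L C "x 0 - xstar"] spd L vpos
    by (simp add: Q_def v k' add.commute mult.assoc)
  finally show ?thesis by (simp add: F_real x_dom xstar)
qed

end
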